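(* Let $S(R_M)$ and $s(k)$ be as defined in the context. Then $$\liminf_{M\to\infty}\frac{S(R_M)}{s(|R_M|)}<1<\limsup_{M\to\infty}\frac{S(R_M)}{s(|R_M|)}.$$
   Context: For a positive integer $n$ and a subset $U\subseteq\mathbb{Z}_n=\mathbb{Z}/n\mathbb{Z}$ of size $k\ge 2$, write its elements as integers $0\le u_1<u_2<\dots<u_k<n$. Put $s_i=u_{i+1}-u_i$ for $1\le i\le k-1$ and $s_k=u_1+n-u_k$. The stochasticity parameter of $U$ is $S(U)=\sum_{i=1}^k s_i^2$. For $2\le k\le n$, $s(k)=s(k,\mathbb{Z}_n)$ denotes the average of $S(U)$ over all subsets $U\subseteq\mathbb{Z}_n$ with $|U|=k$; when $U\subseteq \mathbb{Z}_M$, $s(k)$ is taken with $n=M$. $R_M=\{a^2: a\in\mathbb{Z}_M\}$ is the set of quadratic residues modulo $M$ (including $0$). *)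

theory Defs
  imports Complex_Main "HOL-Library.Extended_Real" "HOL-Library.Liminf_Limsup"
begin

text \<open>Elements of \<open>\<int>\<^sub>n\<close> are represented by their least residues in \<open>{0..<n}\<close>.
  Indices are shifted to start at 0: \<open>gap n U i\<close> is the informal \<open>s\<close> with index \<open>i + 1\<close>,
  the last one wrapping around modulo \<open>n\<close>.  It is meaningful for
  \<open>U \<subseteq> {0..<n}\<close> with \<open>card U \<ge> 2\<close> and \<open>i < card U\<close>.\<close>

definition gap :: "nat \<Rightarrow> nat set \<Rightarrow> nat \<Rightarrow> int" where
  "gap n U i =
     (let u = sorted_list_of_set U; k = card U in
      if i < k - 1 then int (u ! (i + 1)) - int (u ! i)
      else int (u ! 0) + int n - int (u ! (k - 1)))"

definition stochasticity :: "nat \<Rightarrow> nat set \<Rightarrow> int" where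
  "stochasticity n U = (\<Sum>i<card U. (gap n U i)\<^sup>2)"

definition k_subsets :: "nat \<Rightarrow> nat \<Rightarrow> nat set set" where
  "k_subsets n k = {U. U \<subseteq> {0..<n} \<and> card U = k}"

definition mean_stochasticity :: "nat \<Rightarrow> nat \<Rightarrow> real" where
  "mean_stochasticity n k =
     (\<Sum>U\<in>k_subsets n k. real_of_int (stochasticity n U)) / real (card (k_subsets n k))"

definition quadratic_residues :: "nat \<Rightarrow> nat set" where
  "quadratic_residues M = (\<lambda>a. a\<^sup>2 mod M) ` {0..<M}"

end

theory Submission
  imports Defs "HOL-Number_Theory.Number_Theory"
begin

text \<open>
  Since \<open>s\<^sup>2 = 2 (1 + \<dots> + s) - s\<close>, the stochasticity of \<open>U \<subseteq> \<int>\<^sub>n\<close> is \<open>2 D - n\<close>, where \<open>D\<close> is the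
  sum over all \<open>x \<in> \<int>\<^sub>n\<close> of the distance from \<open>x\<close> to the next element of \<open>U\<close>.  Hence
  stochasticity decreases when \<open>U\<close> grows and is multiplicative for periodic sets; summing over
  \<open>U\<close> first gives the mean \<open>s(k) = n (2 (n + 1) / (k + 1) - 1)\<close>.

  For \<open>M = 3\<^sup>m\<close> the set \<open>R\<^sub>M\<close> contains the class of 1 modulo 3, so \<open>S(R\<^sub>M) \<le> 3 M\<close>, and it lies in
  four classes modulo 9, so \<open>s(|R\<^sub>M|)\<close> is at least about \<open>7 M / 2\<close>.  For \<open>M = 53\<^sup>m\<close> the set \<open>R\<^sub>M\<close>
  lies in the preimage of \<open>R\<close> modulo 53, so \<open>S(R\<^sub>M) \<ge> S(R) M / 53 = 171 M / 53\<close>, while the squares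
  of units alone give \<open>|R\<^sub>M| \<ge> 26 M / 53\<close> and therefore \<open>s(|R\<^sub>M|) \<le> 40 M / 13\<close>, which is smaller.
  The prime 53 is the least odd prime \<open>p\<close> for which this comparison succeeds.
\<close>

section \<open>Distance to the next element\<close>

text \<open>The distance is strictly positive even at a point satisfying \<open>P\<close>, so that
  the points from one element up to the next see the distances \<open>s, ..., 1\<close>. The value
  is meaningful only if \<open>P\<close> holds somewhere after \<open>x\<close>.\<close>

definition ahead :: "(nat \<Rightarrow> bool) \<Rightarrow> nat \<Rightarrow> nat" where
  "ahead P x = (LEAST d. 0 < d \<and> P (x + d))"

lemma ahead_eqI:
  assumes "x < y" "P y" "\<And>z. x < z \<Longrightarrow> z < y \<Longrightarrow> \<not> P z"
  shows "ahead P x = y - x"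
  unfolding ahead_def
proof (rule Least_equality)
  show "0 < y - x \<and> P (x + (y - x))"
    using assms(1,2) by simp
  fix d assume d: "0 < d \<and> P (x + d)"
  show "y - x \<le> d"
  proof (rule ccontr)
    assume "\<not> y - x \<le> d"
    then have "x < x + d" "x + d < y"
      using d by auto
    then show False
      using assms(3) d by blast
  qed
qed

lemma ahead_hits:
  assumes "0 < d" "P (x + d)"
  shows "0 < ahead P x" "P (x + ahead P x)"
  using LeastI[of "\<lambda>d. 0 < d \<and> P (x + d)" d] assms by (simp_all add: ahead_def)

lemma ahead_le: "0 < d \<Longrightarrow> P (x + d) \<Longrightarrow> ahead P x \<le> d"
  unfolding ahead_def by (rule Least_le) simp

lemma ahead_antimono:
  assumes "\<And>y. P y \<Longrightarrow> Q y" "0 < d" "P (x + d)"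
  shows "ahead Q x \<le> ahead P x"
  using ahead_hits[of d P x] assms by (intro ahead_le) auto

lemma ahead_mod_periodic:
  "ahead (\<lambda>y. y mod n \<in> U) (x + n) = ahead (\<lambda>y. y mod n \<in> U) x"
proof -
  have "(x + n + d) mod n = (x + d) mod n" for d
    by (metis add.assoc add.commute mod_add_self2)
  then show ?thesis
    by (simp add: ahead_def)
qed

text \<open>Prepares the averaging: the distance becomes the number of \<open>j\<close> such that
  the window of \<open>j\<close> points after \<open>x\<close> misses \<open>P\<close>.\<close>

lemma less_ahead_iff:
  assumes "0 < d" "P (x + d)"
  shows "j < ahead P x \<longleftrightarrow> (\<forall>i\<in>{1..j}. \<not> P (x + i))"
proof
  assume j: "j < ahead P x"
  show "\<forall>i\<in>{1..j}. \<not> P (x + i)"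
  proof (intro ballI notI)
    fix i assume "i \<in> {1..j}" "P (x + i)"
    then show False
      using j ahead_le[of i P x] by simp
  qed
next
  assume "\<forall>i\<in>{1..j}. \<not> P (x + i)"
  then show "j < ahead P x"
    using ahead_hits[of d P x] assms by (metis One_nat_def Suc_leI atLeastAtMost_iff not_less)
qed

section \<open>Sums over periods and over consecutive intervals\<close>

lemma sum_periodic:
  fixes f :: "nat \<Rightarrow> 'a::comm_semiring_1"
  assumes "\<And>x. f (x + q) = f x"
  shows "(\<Sum>x<q * t. f x) = of_nat t * (\<Sum>x<q. f x)"
proof (induction t)
  case (Suc t)
  have shift: "f (x + q * t) = f x" for x
    by (induction t) (use assms in \<open>simp_all add: add.assoc[symmetric] add.commute[of q]\<close>)
  have "(\<Sum>x<q * Suc t. f x) = (\<Sum>x<q * t. f x) + (\<Sum>x=q * t..<q * t + q. f x)"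
    by (subst sum.atLeastLessThan_concat[of 0 "q * t", unfolded atLeast0LessThan])
       (simp_all add: algebra_simps)
  also have "(\<Sum>x=q * t..<q * t + q. f x) = (\<Sum>x<q. f x)"
    using sum.shift_bounds_nat_ivl[of f 0 "q * t" q] shift
    by (simp add: atLeast0LessThan add.commute)
  finally show ?case
    using Suc by (simp add: algebra_simps)
qed simp

lemma card_periodic:
  "card {x\<in>{..<q * t}. P (x mod q)} = t * card {x\<in>{..<q}. P x}"
proof -
  have "card {x\<in>{..<q * t}. P (x mod q)} = (\<Sum>x<q * t. of_bool (P (x mod q)))"
    by (simp add: Int_def)
  also have "\<dots> = t * (\<Sum>x<q. of_bool (P (x mod q)))"
    by (subst sum_periodic) simp_all
  also have "(\<Sum>x<q. of_bool (P (x mod q))) = (\<Sum>x<q. of_bool (P x) :: nat)"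
    by (intro sum.cong) auto
  finally show ?thesis
    by (simp add: Int_def)
qed

text \<open>Lets a sum over the circle start at the smallest element of \<open>U\<close>, which
  makes the wrap-around gap an ordinary interval.\<close>

lemma sum_rotate:
  fixes f :: "nat \<Rightarrow> 'a::comm_monoid_add"
  assumes "\<And>x. f (x + n) = f x" "c \<le> n"
  shows "(\<Sum>x=c..<c + n. f x) = (\<Sum>x<n. f x)"
proof -
  have "(\<Sum>x=c..<c + n. f x) = (\<Sum>x=c..<n. f x) + (\<Sum>x=n..<c + n. f x)"
    using assms(2) by (simp add: sum.atLeastLessThan_concat)
  also have "(\<Sum>x=n..<c + n. f x) = (\<Sum>x=0..<c. f x)"
    using sum.shift_bounds_nat_ivl[of f 0 n c] assms(1) by simp
  also have "(\<Sum>x=c..<n. f x) + (\<Sum>x=0..<c. f x) = (\<Sum>x<n. f x)"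
    using assms(2) sum.atLeastLessThan_concat[of 0 c n f] by (simp add: atLeast0LessThan add.commute)
  finally show ?thesis .
qed

lemma sum_distance_to_end:
  assumes "a \<le> b"
  shows "2 * (\<Sum>x=a..<b. int (b - x)) = (int b - int a)\<^sup>2 + (int b - int a)"
  using assms
proof (induction rule: dec_induct)
  case (step b)
  have "(\<Sum>x=a..<Suc b. int (Suc b - x)) = (\<Sum>x=a..<b. int (b - x) + 1) + 1"
    using step(1) by (simp add: Suc_diff_le add.commute)
  also have "\<dots> = (\<Sum>x=a..<b. int (b - x)) + (int b - int a) + 1"
    using step(1) by (simp add: sum.distrib)
  finally show ?case
    using step by (simp add: power2_eq_square algebra_simps)
qed simp

lemma sum_consecutive_intervals:
  fixes f :: "nat \<Rightarrow> 'a::comm_monoid_add"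
  assumes "\<And>i. i < k \<Longrightarrow> v i \<le> v (Suc i)"
  shows "v 0 \<le> v k \<and> (\<Sum>i<k. \<Sum>x=v i..<v (Suc i). f x) = (\<Sum>x=v 0..<v k. f x)"
  using assms
proof (induction k)
  case (Suc k)
  then have "v 0 \<le> v k" "v k \<le> v (Suc k)"
    by auto
  moreover from this have "v 0 \<le> v (Suc k)"
    by (rule order_trans)
  ultimately show ?case
    using Suc by (simp add: sum.atLeastLessThan_concat)
qed simp

text \<open>The elements of \<open>U\<close> cut the circle into half-open intervals. On each of
  them the distance decreases by one per step, so a gap \<open>g\<close> contributes
  \<open>1 + ... + g\<close>, and the gaps add up to \<open>n\<close>.\<close>

theorem stochasticity_eq_sum_ahead:
  assumes U: "U \<subseteq> {0..<n}" "U \<noteq> {}"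
  shows "stochasticity n U = 2 * (\<Sum>x<n. int (ahead (\<lambda>y. y mod n \<in> U) x)) - int n"
proof -
  define P where "P = (\<lambda>y. y mod n \<in> U)"
  define u where "u = sorted_list_of_set U"
  define k where "k = card U"
  \<comment> \<open>The closing value is the smallest element moved up by one period, so the last
    gap needs no separate treatment below.\<close>
  define v where "v i = (if i < k then u ! i else u ! 0 + n)" for i
  have fin: "finite U"
    using U(1) finite_subset by blast
  have k: "k > 0"
    using fin U(2) by (simp add: k_def card_gt_0_iff)
  have len: "length u = k" and set_u: "set u = U" and sorted: "sorted_wrt (<) u"
    using fin by (simp_all add: u_def k_def)
  have u_less: "u ! i < u ! j" if "i < j" "j < k" for i j
    using sorted_wrt_nth_less[OF sorted] that len by simp
  have u_in: "u ! i \<in> U" if "i < k" for i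
    using that len set_u by (metis nth_mem)
  have u_lt: "u ! i < n" if "i < k" for i
    using u_in[OF that] U(1) by auto
  have v_less: "v i < v (Suc i)" if "i < k" for i
    using that u_less[of i "Suc i"] u_lt[of i] unfolding v_def by auto
  have gap_v: "gap n U i = int (v (Suc i)) - int (v i)" if "i < k" for i
  proof (cases "Suc i < k")
    case False
    then have "i = k - 1"
      using that by simp
    then show ?thesis
      using k by (simp add: gap_def Let_def v_def flip: u_def k_def)
  qed (use that in \<open>simp add: gap_def less_diff_conv Let_def v_def flip: u_def k_def\<close>)
  have P_v: "P (v (Suc i))" if "i < k" for i
    using u_in[of "Suc i"] u_lt[of "Suc i"] u_in[of 0] u_lt[of 0] k by (simp add: P_def v_def)
  have not_P: "\<not> P z" if i: "i < k" and z: "v i < z" "z < v (Suc i)" for i z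
  proof
    assume "P z"
    then obtain j where j: "j < k" "z mod n = u ! j"
      using set_u len unfolding P_def by (metis in_set_conv_nth)
    have u0: "u ! 0 \<le> u ! j"
      using u_less[of 0 j] j(1) by (cases "j = 0") auto
    show False
    \<comment> \<open>Below \<open>n\<close>, \<open>z\<close> would itself be an element of
      \<open>U\<close> strictly between two consecutive ones; from \<open>n\<close> on, its residue
      would be below the smallest element.\<close>
    proof (cases "z < n")
      case True
      then have zj: "z = u ! j"
        using j by simp
      have "i < j"
        using z(1) i zj u_less[of j i] by (cases i j rule: linorder_cases) (auto simp: v_def)
      moreover have "j < Suc i"
        using z(2) zj j(1) u_less[of "Suc i" j]
        by (cases "Suc i" j rule: linorder_cases) (auto simp: v_def split: if_splits)
      ultimately show False
        by simp
    next
      case False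
      have "z < u ! 0 + n"
        using z(2) u_lt[of "Suc i"] False by (auto simp: v_def split: if_splits)
      then have "z mod n = z - n" "z - n < u ! 0"
        using False u_lt[OF k] by (auto simp: le_mod_geq)
      then show False
        using j u0 by simp
    qed
  qed
  have ahead_v: "ahead P x = v (Suc i) - x" if "i < k" "x \<in> {v i..<v (Suc i)}" for i x
    using that P_v not_P by (intro ahead_eqI) auto
  have periodic: "ahead P (x + n) = ahead P x" for x
    unfolding P_def by (rule ahead_mod_periodic)
  have "2 * (\<Sum>x<n. int (ahead P x)) = 2 * (\<Sum>x=v 0..<v k. int (ahead P x))"
    using sum_rotate[of "\<lambda>x. int (ahead P x)" n "u ! 0"] periodic u_lt[OF k] k
    by (simp add: v_def)
  also have "\<dots> = (\<Sum>i<k. 2 * (\<Sum>x=v i..<v (Suc i). int (v (Suc i) - x)))"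
    using sum_consecutive_intervals[of k v "\<lambda>x. int (ahead P x)"] v_less ahead_v
    by (simp add: less_imp_le sum_distrib_left[symmetric])
  also have "\<dots> = (\<Sum>i<k. (gap n U i)\<^sup>2 + (int (v (Suc i)) - int (v i)))"
    using v_less by (intro sum.cong refl) (simp add: sum_distance_to_end less_imp_le gap_v del: of_nat_diff)
  also have "\<dots> = stochasticity n U + (\<Sum>i<k. int (v (Suc i)) - int (v i))"
    by (simp add: sum.distrib stochasticity_def k_def)
  also have "(\<Sum>i<k. int (v (Suc i)) - int (v i)) = int n"
    using k sum_lessThan_telescope[of "\<lambda>i. int (v i)" k] by (simp add: v_def)
  finally show ?thesis
    by (simp add: P_def)
qed

lemma ex_ahead:
  fixes x n :: nat
  assumes "U \<subseteq> {0..<n}" "U \<noteq> {}"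
  shows "\<exists>d>0. (x + d) mod n \<in> U"
proof -
  obtain u where u: "u \<in> U" "u < n"
    using assms by (meson all_not_in_conv atLeastLessThan_iff subsetD)
  \<comment> \<open>The witness first moves up to the next multiple of \<open>n\<close>, a positive
    step, and then on by \<open>u\<close>.\<close>
  have "(x + ((n - x mod n) + u)) mod n = u"
  proof -
    have "(x + ((n - x mod n) + u)) mod n = (x mod n + ((n - x mod n) + u)) mod n"
      by (simp add: mod_add_left_eq)
    also have "x mod n + ((n - x mod n) + u) = n + u"
      using u(2) mod_less_divisor[of n x] by linarith
    finally show ?thesis
      using u(2) by simp
  qed
  moreover have "0 < (n - x mod n) + u"
    using u(2) mod_less_divisor[of n x] by linarith
  ultimately show ?thesis
    using u(1) by metis
qed

section \<open>Comparison with preimages of sets modulo a divisor\<close>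

lemma stochasticity_eq_sum_ahead_multiple:
  assumes "V \<subseteq> {0..<q}" "V \<noteq> {}"
  shows "int t * stochasticity q V
    = 2 * (\<Sum>x<q * t. int (ahead (\<lambda>y. y mod q \<in> V) x)) - int (q * t)"
  unfolding stochasticity_eq_sum_ahead[OF assms]
  using sum_periodic[of "\<lambda>x. int (ahead (\<lambda>y. y mod q \<in> V) x)" q t]
  by (simp add: ahead_mod_periodic algebra_simps)

text \<open>\<open>U\<close> lies in the preimage of \<open>V\<close>, and a larger set has
  distances that are no longer at any point. The distances to the preimage have period
  \<open>q\<close>, hence the factor \<open>t\<close>.\<close>

lemma stochasticity_ge_periodic:
  assumes "U \<subseteq> {0..<q * t}" "U \<noteq> {}" "V \<subseteq> {0..<q}" "V \<noteq> {}"
    and "\<And>x. x \<in> U \<Longrightarrow> x mod q \<in> V"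
  shows "int t * stochasticity q V \<le> stochasticity (q * t) U"
proof -
  have "ahead (\<lambda>y. y mod q \<in> V) x \<le> ahead (\<lambda>y. y mod (q * t) \<in> U) x" for x
  proof -
    obtain d where "d > 0" "(x + d) mod (q * t) \<in> U"
      using ex_ahead[OF assms(1,2)] by blast
    moreover have "y mod q \<in> V" if "y mod (q * t) \<in> U" for y
      using assms(5)[OF that] by (simp add: mod_mod_cancel)
    ultimately show ?thesis
      using ahead_antimono[of "\<lambda>y. y mod (q * t) \<in> U" "\<lambda>y. y mod q \<in> V"] by blast
  qed
  then show ?thesis
    unfolding stochasticity_eq_sum_ahead[OF assms(1,2)] stochasticity_eq_sum_ahead_multiple[OF assms(3,4)]
    by (simp add: sum_mono)
qed

text \<open>The same comparison with the inclusion reversed: here \<open>U\<close> contains the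
  whole preimage of \<open>V\<close>.\<close>

lemma stochasticity_le_periodic:
  assumes "U \<subseteq> {0..<q * t}" "V \<subseteq> {0..<q}" "V \<noteq> {}" "t > 0"
    and "\<And>x. x < q * t \<Longrightarrow> x mod q \<in> V \<Longrightarrow> x \<in> U"
  shows "stochasticity (q * t) U \<le> int t * stochasticity q V"
proof -
  have q: "q > 0"
    using assms(2,3) by (cases "q = 0") auto
  have sub: "y mod (q * t) \<in> U" if "y mod q \<in> V" for y
    using assms(4,5) q that by (simp add: mod_mod_cancel)
  have "ahead (\<lambda>y. y mod (q * t) \<in> U) x \<le> ahead (\<lambda>y. y mod q \<in> V) x" for x
  proof -
    obtain d where "d > 0" "(x + d) mod q \<in> V"
      using ex_ahead[OF assms(2,3)] by blast
    then show ?thesis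
      using ahead_antimono[of "\<lambda>y. y mod q \<in> V" "\<lambda>y. y mod (q * t) \<in> U"] sub by blast
  qed
  moreover have "U \<noteq> {}"
    using ex_ahead[OF assms(2,3)] sub by blast
  ultimately show ?thesis
    unfolding stochasticity_eq_sum_ahead_multiple[OF assms(2,3)]
    using assms(1) by (simp add: stochasticity_eq_sum_ahead sum_mono)
qed

section \<open>The mean over all subsets of a given size\<close>

lemma card_k_subsets: "card (k_subsets n k) = n choose k"
  unfolding k_subsets_def by (simp add: n_subsets)

lemma card_k_subsets_avoiding:
  assumes "A \<subseteq> {0..<n}"
  shows "card {U \<in> k_subsets n k. U \<inter> A = {}} = (n - card A) choose k"
proof -
  have "{U \<in> k_subsets n k. U \<inter> A = {}} = {U. U \<subseteq> {0..<n} - A \<and> card U = k}"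
    by (auto simp: k_subsets_def)
  moreover have "card ({0..<n} - A) = n - card A"
    using assms by (simp add: card_Diff_subset finite_subset)
  ultimately show ?thesis
    by (simp add: n_subsets)
qed

text \<open>Counting pairs of a subset and a window of \<open>j\<close> points after
  \<open>x\<close> that it avoids gives the sum of the \<open>(n - j) choose k\<close>, which the
  hockey-stick identity evaluates.\<close>

lemma sum_ahead_k_subsets:
  assumes "0 < k" "n > 0"
  shows "(\<Sum>U\<in>k_subsets n k. ahead (\<lambda>y. y mod n \<in> U) x) = Suc n choose Suc k"
proof -
  define A where "A j = (\<lambda>i. (x + i) mod n) ` {1..j}" for j
  have A: "A j \<subseteq> {0..<n}" "card (A j) = j" if "j < n" for j
  proof -
    show "A j \<subseteq> {0..<n}"
      using assms(2) by (auto simp: A_def)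
    have "inj_on (\<lambda>i. (x + i) mod n) {1..j}"
    proof (rule inj_onI)
      fix a b assume ab: "a \<in> {1..j}" "b \<in> {1..j}" "(x + a) mod n = (x + b) mod n"
      then have "[a = b] (mod n)"
        using cong_add_lcancel_nat unfolding cong_def by metis
      then show "a = b"
        using ab that by (intro cong_less_modulus_unique_nat[of a b n]) auto
    qed
    then show "card (A j) = j"
      by (simp add: A_def card_image)
  qed
  have fin: "finite (k_subsets n k)"
    by (simp add: k_subsets_def)
  have ahead_eq: "ahead (\<lambda>y. y mod n \<in> U) x = (\<Sum>j<n. of_bool (U \<inter> A j = {}))"
    if "U \<in> k_subsets n k" for U
  proof -
    have U: "U \<subseteq> {0..<n}" "U \<noteq> {}"
      using that assms(1) by (auto simp: k_subsets_def)
    obtain d where d: "d > 0" "(x + d) mod n \<in> U"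
      using ex_ahead[OF U] by blast
    have iff: "j < ahead (\<lambda>y. y mod n \<in> U) x \<longleftrightarrow> U \<inter> A j = {}" for j
      using less_ahead_iff[of d "\<lambda>y. y mod n \<in> U", OF d] by (auto simp: A_def)
    \<comment> \<open>Any hit can be moved into the first \<open>n\<close> points after
      \<open>x\<close>, so windows with \<open>j < n\<close> suffice.\<close>
    have "\<not> n < ahead (\<lambda>y. y mod n \<in> U) x"
    proof -
      have "(x + Suc ((d - 1) mod n)) mod n = (x + d) mod n"
        using d(1) by (metis Suc_diff_1 mod_Suc_eq mod_add_right_eq)
      moreover have "Suc ((d - 1) mod n) \<in> {1..n}"
        using assms(2) by (simp add: Suc_leI)
      ultimately show ?thesis
        using less_ahead_iff[of d "\<lambda>y. y mod n \<in> U", OF d] d(2) by metis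
    qed
    then have "{j\<in>{..<n}. U \<inter> A j = {}} = {..<ahead (\<lambda>y. y mod n \<in> U) x}"
      unfolding iff[symmetric] by auto
    then have "card {j\<in>{..<n}. U \<inter> A j = {}} = ahead (\<lambda>y. y mod n \<in> U) x"
      by simp
    then show ?thesis
      by (simp add: Int_def)
  qed
  have "(\<Sum>U\<in>k_subsets n k. ahead (\<lambda>y. y mod n \<in> U) x)
      = (\<Sum>j<n. \<Sum>U\<in>k_subsets n k. of_bool (U \<inter> A j = {}))"
    by (simp add: ahead_eq sum.swap[of _ "k_subsets n k"] del: sum_of_bool_eq)
  also have "\<dots> = (\<Sum>j<n. card {U \<in> k_subsets n k. U \<inter> A j = {}})"
    using fin by (simp add: Int_def)
  also have "\<dots> = (\<Sum>j<n. (n - j) choose k)"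
    by (intro sum.cong) (simp_all add: card_k_subsets_avoiding A)
  \<comment> \<open>The added term \<open>0 choose k\<close> vanishes because \<open>k > 0\<close>;
    it makes the range symmetric under \<open>j\<close> to \<open>n - j\<close>.\<close>
  also have "\<dots> = (\<Sum>j<Suc n. (n - j) choose k)"
    using assms(1) by simp
  also have "\<dots> = (\<Sum>j\<le>n. j choose k)"
    by (subst sum.nat_diff_reindex[symmetric]) (simp add: lessThan_Suc_atMost)
  finally show ?thesis
    by (simp add: sum_choose_upper)
qed

text \<open>Each of the \<open>n\<close> points contributes the same total
  \<open>Suc n choose Suc k\<close>; dividing by \<open>n choose k\<close> leaves
  \<open>(n + 1) / (k + 1)\<close> by the absorption identity.\<close>

theorem mean_stochasticity_eq:
  assumes "0 < k" "k \<le> n"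
  shows "mean_stochasticity n k = n * (2 * (real n + 1) / (real k + 1) - 1)"
proof -
  have n: "n > 0"
    using assms by simp
  have "(\<Sum>U\<in>k_subsets n k. stochasticity n U)
      = (\<Sum>U\<in>k_subsets n k. 2 * (\<Sum>x<n. int (ahead (\<lambda>y. y mod n \<in> U) x)) - int n)"
    using assms(1) by (intro sum.cong stochasticity_eq_sum_ahead) (auto simp: k_subsets_def)
  also have "\<dots> = 2 * (\<Sum>x<n. \<Sum>U\<in>k_subsets n k. int (ahead (\<lambda>y. y mod n \<in> U) x))
      - int n * int (n choose k)"
    by (simp add: sum_subtractf sum_distrib_left[symmetric] sum.swap[of _ "k_subsets n k"] card_k_subsets)
  also have "\<dots> = 2 * int n * int (Suc n choose Suc k) - int n * int (n choose k)"
    using sum_ahead_k_subsets[OF assms(1) n] by (simp flip: of_nat_sum del: binomial_Suc_Suc)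
  finally have "(\<Sum>U\<in>k_subsets n k. real_of_int (stochasticity n U))
      = 2 * real n * real (Suc n choose Suc k) - real n * real (n choose k)"
    by (simp flip: of_int_sum del: binomial_Suc_Suc)
  moreover have "real (Suc n choose Suc k) = (real n + 1) / (real k + 1) * real (n choose k)"
  proof -
    have "real (Suc k * (Suc n choose Suc k)) = real (Suc n * (n choose k))"
      by (simp only: Suc_times_binomial_eq mult.commute)
    then show ?thesis
      by (simp add: field_simps del: binomial_Suc_Suc)
  qed
  moreover have "n choose k > 0"
    using assms(2) by simp
  ultimately show ?thesis
    by (simp add: mean_stochasticity_def card_k_subsets field_simps del: binomial_Suc_Suc)
qed

section \<open>Squares modulo prime powers\<close>

lemma quadratic_residues_bounded: "M > 0 \<Longrightarrow> quadratic_residues M \<subseteq> {0..<M}"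
  by (auto simp: quadratic_residues_def)

lemma zero_in_quadratic_residues: "M > 0 \<Longrightarrow> 0 \<in> quadratic_residues M"
  by (auto simp: quadratic_residues_def image_iff intro!: bexI[of _ 0])

lemma quadratic_residues_upt: "quadratic_residues M = set (map (\<lambda>a. a\<^sup>2 mod M) [0..<M])"
  by (simp add: quadratic_residues_def)

text \<open>The units below \<open>M / 2\<close> represent all units up to sign, so they are at
  least half of the totient in number, and their squares are pairwise distinct.\<close>

lemma card_unit_squares_ge:
  fixes p :: nat
  assumes p: "prime p" "p > 2" and m: "m > 0"
  shows "(p - 1) * p ^ (m - 1) \<le> 2 * card {x \<in> quadratic_residues (p ^ m). \<not> p dvd x}"
proof -
  define M where "M = p ^ m"
  define A where "A = {a. 2 * a < M \<and> \<not> p dvd a}"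
  have M: "M > 0" "p dvd M"
    using p m by (auto simp: M_def prime_gt_0_nat)
  have "odd p"
    using p prime_odd_nat by blast
  then have "odd M"
    by (simp add: M_def)
  have dvdM: "p dvd x mod M \<longleftrightarrow> p dvd x" for x
    using M(2) by (simp add: dvd_mod_iff)
  have finA: "finite A"
    by (rule finite_subset[of _ "{..<M}"]) (auto simp: A_def)
  have "inj_on (\<lambda>a. a\<^sup>2 mod M) A"
  proof (rule linorder_inj_onI')
    fix a b assume ab: "a \<in> A" "b \<in> A" "a < b"
    show "a\<^sup>2 mod M \<noteq> b\<^sup>2 mod M"
    proof
      assume "a\<^sup>2 mod M = b\<^sup>2 mod M"
      then have "M dvd b\<^sup>2 - a\<^sup>2"
        using ab(3) by (metis less_imp_le mod_eq_dvd_iff_nat power_mono zero_le)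
      then have dvd: "p ^ m dvd (b - a) * (b + a)"
        using ab(3) by (simp add: M_def power2_eq_square diff_mult_distrib algebra_simps diff_mult_distrib2)
      \<comment> \<open>Hence one factor is prime to \<open>p\<close> and all of
        \<open>p ^ m\<close> divides the other, although both factors lie strictly between 0 and
        \<open>M\<close>.\<close>
      have "\<not> (p dvd b - a \<and> p dvd b + a)"
      proof
        assume "p dvd b - a \<and> p dvd b + a"
        then have "p dvd (b + a) - (b - a)"
          using dvd_diff_nat by blast
        also have "(b + a) - (b - a) = 2 * a"
          using ab(3) by simp
        finally have "p dvd 2 \<or> p dvd a"
          using p(1) prime_dvd_mult_iff by blast
        then show False
          using ab(1) p(2) by (auto simp: A_def dest: dvd_imp_le)
      qed
      then have "coprime (p ^ m) (b - a) \<or> coprime (p ^ m) (b + a)"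
        using p(1) prime_imp_coprime by auto
      then have "M dvd b - a \<or> M dvd b + a"
        using dvd unfolding M_def by (metis coprime_dvd_mult_left_iff coprime_dvd_mult_right_iff)
      then show False
        using ab by (auto simp: A_def dest!: dvd_imp_le)
    qed
  qed
  moreover have "(\<lambda>a. a\<^sup>2 mod M) ` A \<subseteq> {x \<in> quadratic_residues M. \<not> p dvd x}"
    using p(1) by (auto simp: A_def quadratic_residues_def dvdM prime_dvd_power_iff)
  ultimately have "card A \<le> card {x \<in> quadratic_residues M. \<not> p dvd x}"
    using M quadratic_residues_bounded[OF M(1)]
    by (metis (no_types, lifting) card_image card_mono finite_atLeastLessThan finite_subset mem_Collect_eq subsetI)
  moreover have "totatives M \<subseteq> A \<union> (\<lambda>a. M - a) ` A"
  proof
    fix x assume x: "x \<in> totatives M"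
    then have xM: "0 < x" "x \<le> M" "\<not> p dvd x"
      using p m by (auto simp: totatives_def M_def prime_imp_coprime coprime_commute
        dest: coprime_common_divisor_nat)
    show "x \<in> A \<union> (\<lambda>a. M - a) ` A"
    proof (cases "2 * x < M")
      case False
      \<comment> \<open>Strict because \<open>M\<close> is odd: no unit is its own negative.\<close>
      have "2 * (M - x) < M"
        using False xM \<open>odd M\<close> by (cases "2 * x = M") auto
      moreover have "\<not> p dvd M - x"
        using xM M(2) dvd_diffD1 by blast
      ultimately have "M - x \<in> A" "x = M - (M - x)"
        using xM by (auto simp: A_def)
      then show ?thesis
        by blast
    qed (use xM in \<open>auto simp: A_def\<close>)
  qed
  then have "card (totatives M) \<le> card A + card ((\<lambda>a. M - a) ` A)"
    using finA by (meson card_Un_le card_mono finite_UnI finite_imageI order_trans)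
  moreover have "card ((\<lambda>a. M - a) ` A) \<le> card A"
    using finA by (rule card_image_le)
  moreover have "card (totatives M) = (p - 1) * p ^ (m - 1)"
    using totient_prime_power[OF p(1) m] by (simp add: totient_def M_def mult.commute)
  ultimately show ?thesis
    by (simp add: M_def)
qed

lemma quadratic_residues_mod:
  assumes "q > 0" "q dvd M" "x \<in> quadratic_residues M"
  shows "x mod q \<in> quadratic_residues q"
proof -
  obtain a where "x = a\<^sup>2 mod M"
    using assms(3) by (auto simp: quadratic_residues_def)
  then have "x mod q = (a mod q)\<^sup>2 mod q"
    using assms(2) by (simp add: mod_mod_cancel power_mod)
  then show ?thesis
    using assms(1) by (auto simp: quadratic_residues_def)
qed

text \<open>Counting replaces Hensel lifting: the unit squares lie in the class of 1 modulo 3, which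
  has \<open>3 ^ (m - 1)\<close> elements, and there are at least that many of them.\<close>

lemma quadratic_residues_3_power:
  assumes "m > 0" "x < 3 ^ m" "x mod 3 = 1"
  shows "x \<in> quadratic_residues (3 ^ m)"
proof -
  define Q where "Q = {x \<in> quadratic_residues (3 ^ m). \<not> 3 dvd x}"
  define T where "T = {x\<in>{..<3 * 3 ^ (m - 1)}. x mod 3 = (1::nat)}"
  have m: "(3::nat) ^ m = 3 * 3 ^ (m - 1)"
    using assms(1) by (simp add: power_eq_if)
  have "card T = 3 ^ (m - 1) * card {x\<in>{..<3}. x = (1::nat)}"
    unfolding T_def by (rule card_periodic)
  also have "{x\<in>{..<3}. x = (1::nat)} = {1}"
    by auto
  finally have "card T = 3 ^ (m - 1)"
    by simp
  then have "card T \<le> card Q"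
    using card_unit_squares_ge[of 3 m] assms(1) by (simp add: Q_def)
  moreover have "Q \<subseteq> T"
  proof
    fix x assume x: "x \<in> Q"
    then have "x mod 3 \<in> quadratic_residues 3"
      using quadratic_residues_mod[of 3 "3 ^ m" x] assms(1) by (simp add: Q_def)
    moreover have "quadratic_residues 3 = {0, 1}"
      by (simp add: quadratic_residues_upt upt_rec[of 0] upt_rec[of "Suc 0"]
        numeral_2_eq_2[symmetric] del: set_upt)
    moreover have "x < 3 ^ m"
      using x quadratic_residues_bounded[of "3 ^ m"] by (auto simp: Q_def)
    ultimately show "x \<in> T"
      using x m by (auto simp: Q_def T_def mod_eq_0_iff_dvd)
  qed
  ultimately have "Q = T"
    by (intro card_seteq) (auto simp: T_def)
  then show ?thesis
    using assms m by (auto simp: Q_def T_def)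
qed

text \<open>Reduction modulo 9 is essential for the comparison: modulo 3 the density bound would be
  only \<open>2/3\<close>, giving a mean of about \<open>2 M\<close>, below the bound
  \<open>3 M\<close> for the stochasticity.\<close>

lemma card_quadratic_residues_3_power_le:
  assumes "m \<ge> 2"
  shows "card (quadratic_residues (3 ^ m)) \<le> 4 * 3 ^ (m - 2)"
proof -
  have m: "(3::nat) ^ m = 9 * 3 ^ (m - 2)"
    using assms by (simp add: power_eq_if numeral_2_eq_2)
  have "quadratic_residues (3 ^ m) \<subseteq> {x\<in>{..<9 * 3 ^ (m - 2)}. x mod 9 \<in> quadratic_residues 9}"
    using quadratic_residues_mod[of 9 "3 ^ m"] quadratic_residues_bounded[of "3 ^ m"] m by auto
  then have "card (quadratic_residues (3 ^ m))
      \<le> card {x\<in>{..<9 * 3 ^ (m - 2)}. x mod 9 \<in> quadratic_residues 9}"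
    by (intro card_mono) auto
  also have "\<dots> = 3 ^ (m - 2) * card {x\<in>{..<9}. x \<in> quadratic_residues 9}"
    by (rule card_periodic)
  also have "quadratic_residues 9 = {0, 1, 4, 7}"
    by (auto simp add: quadratic_residues_upt upt_rec[of 0] upt_rec[of "Suc 0"]
      numeral_2_eq_2[symmetric] simp del: set_upt)
  also have "{x\<in>{..<9}. x \<in> {0::nat, 1, 4, 7}} = {0, 1, 4, 7}"
    by auto
  finally show ?thesis
    by simp
qed

section \<open>The two subsequences\<close>

lemma stochasticity_ratio_3_power:
  assumes "m \<ge> 4"
  shows "real_of_int (stochasticity (3 ^ m) (quadratic_residues (3 ^ m)))
    / mean_stochasticity (3 ^ m) (card (quadratic_residues (3 ^ m))) \<le> 9 / 10"
proof -
  define M :: nat where "M = 3 ^ m"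
  define R where "R = quadratic_residues M"
  have m: "M = 3 * 3 ^ (m - 1)" "M = 9 * 3 ^ (m - 2)"
    using assms by (simp_all add: M_def power_eq_if numeral_2_eq_2)
  have "(3::nat) ^ 4 \<le> 3 ^ m"
    using assms by (intro power_increasing) auto
  then have M: "M \<ge> 81"
    by (simp add: M_def)
  have R: "R \<subseteq> {0..<M}" "1 \<in> R"
    using quadratic_residues_bounded[of M] quadratic_residues_3_power[of m 1] M assms
    by (auto simp: R_def M_def)
  have "stochasticity (3 * 3 ^ (m - 1)) R \<le> int (3 ^ (m - 1)) * stochasticity 3 {1}"
    using R(1) quadratic_residues_3_power[of m] assms m(1)
    by (intro stochasticity_le_periodic) (auto simp: R_def M_def)
  also have "stochasticity 3 {1} = 9"
    by (simp add: stochasticity_def gap_def)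
  finally have "stochasticity M R \<le> 3 * int M"
    using m(1) by simp
  then have "real_of_int (stochasticity M R) \<le> real_of_int (3 * int M)"
    by (rule of_int_le_iff[THEN iffD2])
  then have S: "real_of_int (stochasticity M R) \<le> 3 * real M"
    by simp
  have k: "0 < card R" "card R \<le> M" "9 * card R \<le> 4 * M"
    using R card_mono[OF _ R(1)] card_quadratic_residues_3_power_le[of m] assms m(2) finite_subset[OF R(1)]
    by (auto simp: card_gt_0_iff R_def M_def)
  \<comment> \<open>The constant \<open>13/3\<close> is slightly below the limit \<open>9/2\<close>
    belonging to density \<open>4/9\<close>. The inequality then amounts to
    \<open>M >= 63/2\<close>, which 27 misses and 81 meets. Subtracting 1 leaves
    \<open>10/3\<close>, and \<open>3 / (10/3) = 9/10\<close>.\<close>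
  have "13 / 3 * (real (card R) + 1) \<le> 2 * (real M + 1)"
    using of_nat_mono[OF k(3), where ?'a = real] of_nat_mono[OF M, where ?'a = real] by simp
  then have "13 / 3 \<le> 2 * (real M + 1) / (real (card R) + 1)"
    by (simp add: field_simps)
  then have "real M * (10 / 3) \<le> mean_stochasticity M (card R)"
    unfolding mean_stochasticity_eq[OF k(1,2)] by (intro mult_left_mono) auto
  then have "real_of_int (stochasticity M R) \<le> 9 / 10 * mean_stochasticity M (card R)"
      "0 < mean_stochasticity M (card R)"
    using S M by auto
  then show ?thesis
    by (simp add: R_def M_def divide_le_eq)
qed

text \<open>A form that the simplifier can evaluate on an explicit list; the appended
  \<open>hd xs + n\<close> supplies the wrap-around gap.\<close>

lemma stochasticity_set_strict_sorted:
  assumes "sorted_wrt (<) xs" "xs \<noteq> []"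
  shows "stochasticity n (set xs) = (\<Sum>(a,b)\<leftarrow>zip xs (tl xs @ [hd xs + n]). (int b - int a)\<^sup>2)"
proof -
  have u: "sorted_list_of_set (set xs) = xs" "card (set xs) = length xs"
    using assms(1) by (simp_all add: strict_sorted_iff sorted_list_of_set.idem_if_sorted_distinct distinct_card)
  have "gap n (set xs) i = int ((tl xs @ [hd xs + n]) ! i) - int (xs ! i)" if "i < length xs" for i
  proof (cases "Suc i < length xs")
    case False
    then have "i = length xs - 1"
      using that by simp
    then show ?thesis
      using assms(2) by (simp add: gap_def u nth_append hd_conv_nth)
  qed (use that in \<open>simp add: gap_def u nth_append nth_tl less_diff_conv\<close>)
  then show ?thesis
    by (simp add: stochasticity_def u sum_list_sum_nth atLeast0LessThan)
qed

text \<open>The two gaps of length 7, from 17 to 24 and from 29 to 36, account for 98 of the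
  total.\<close>

lemma stochasticity_quadratic_residues_53:
  "stochasticity 53 (quadratic_residues 53) = 171"
proof -
  have residues: "quadratic_residues 53 = set [0, 1, 4, 6, 7, 9, 10, 11, 13, 15, 16, 17, 24, 25, 28, 29,
      36, 37, 38, 40, 42, 43, 44, 46, 47, 49, 52]"
    by (auto simp add: quadratic_residues_upt upt_rec[of 0] upt_rec[of "Suc 0"]
      numeral_2_eq_2[symmetric] simp del: set_upt)
  show ?thesis
    unfolding residues by (subst stochasticity_set_strict_sorted) simp_all
qed

lemma stochasticity_ratio_53_power:
  assumes "m > 0"
  shows "26 / 25 \<le> real_of_int (stochasticity (53 ^ m) (quadratic_residues (53 ^ m)))
    / mean_stochasticity (53 ^ m) (card (quadratic_residues (53 ^ m)))"
proof -
  define M :: nat where "M = 53 ^ m"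
  define R where "R = quadratic_residues M"
  have m: "M = 53 * 53 ^ (m - 1)"
    using assms by (simp add: M_def power_eq_if)
  have M: "M > 0"
    by (simp add: M_def)
  have R: "R \<subseteq> {0..<M}" "0 \<in> R"
    using quadratic_residues_bounded[OF M] zero_in_quadratic_residues[OF M] by (simp_all add: R_def)
  have "int (53 ^ (m - 1)) * stochasticity 53 (quadratic_residues 53)
      \<le> stochasticity (53 * 53 ^ (m - 1)) R"
  proof (rule stochasticity_ge_periodic)
    show "R \<subseteq> {0..<53 * 53 ^ (m - 1)}" "R \<noteq> {}"
      using R m by auto
    show "quadratic_residues 53 \<subseteq> {0..<53}" "quadratic_residues 53 \<noteq> {}"
      using quadratic_residues_bounded[of 53] zero_in_quadratic_residues[of 53] by auto
    show "x mod 53 \<in> quadratic_residues 53" if "x \<in> R" for x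
      using quadratic_residues_mod[of 53 M x] that m by (simp add: R_def)
  qed
  then have "171 * int (53 ^ (m - 1)) \<le> stochasticity M R"
    using m by (simp add: stochasticity_quadratic_residues_53)
  then have "real_of_int (171 * int (53 ^ (m - 1))) \<le> real_of_int (stochasticity M R)"
    by (rule of_int_le_iff[THEN iffD2])
  then have S: "171 / 53 * real M \<le> real_of_int (stochasticity M R)"
    using m by simp
  have "prime (53::nat)"
    by simp
  then have "(53 - 1) * 53 ^ (m - 1) \<le> 2 * card {x \<in> R. \<not> 53 dvd x}"
    unfolding R_def M_def using assms by (intro card_unit_squares_ge) auto
  also have "card {x \<in> R. \<not> 53 dvd x} \<le> card R"
    using finite_subset[OF R(1)] by (intro card_mono) auto
  finally have k3: "26 * M \<le> 53 * card R"
    using m by simp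
  have k: "0 < card R" "card R \<le> M"
    using R card_mono[OF _ R(1)] finite_subset[OF R(1)] by (auto simp: card_gt_0_iff)
  \<comment> \<open>Here \<open>53/13\<close> is twice the reciprocal of the density
    \<open>26/53\<close>. As it exceeds 2, the added ones help and every \<open>m > 0\<close> works.
    Subtracting 1 gives \<open>40/13\<close>.\<close>
  have "2 * (real M + 1) \<le> 53 / 13 * (real (card R) + 1)"
    using of_nat_mono[OF k3, where ?'a = real] by simp
  then have "2 * (real M + 1) / (real (card R) + 1) \<le> 53 / 13"
    by (simp add: field_simps)
  then have upper: "mean_stochasticity M (card R) \<le> real M * (40 / 13)"
    unfolding mean_stochasticity_eq[OF k] by (intro mult_left_mono) auto
  have "1 < 2 * (real M + 1) / (real (card R) + 1)"
    using k(2) by (simp add: field_simps)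
  then have "0 < mean_stochasticity M (card R)"
    unfolding mean_stochasticity_eq[OF k] using M by simp
  \<comment> \<open>The two bounds have ratio \<open>(171/53) / (40/13) = 2223/2120\<close>, which
    exceeds \<open>26/25\<close>.\<close>
  moreover have "26 / 25 * mean_stochasticity M (card R) \<le> real_of_int (stochasticity M R)"
    using S upper by simp
  ultimately show ?thesis
    by (simp add: R_def M_def le_divide_eq)
qed

theorem theorem1p1:
  shows "liminf (\<lambda>M::nat. ereal (real_of_int (stochasticity M (quadratic_residues M)) /
             mean_stochasticity M (card (quadratic_residues M)))) < 1
       \<and> 1 < limsup (\<lambda>M::nat. ereal (real_of_int (stochasticity M (quadratic_residues M)) /
             mean_stochasticity M (card (quadratic_residues M))))"
    (is "liminf ?X < 1 \<and> 1 < limsup ?X")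
proof
  have mono: "strict_mono (\<lambda>m. b ^ m)" if "b > 1" for b :: nat
    using that by (intro strict_monoI) simp
  \<comment> \<open>Passing to a subsequence can only raise the liminf and lower the limsup, so
    bounds along the powers of 3 and of 53 suffice.\<close>
  have "liminf ?X \<le> liminf (?X \<circ> (\<lambda>m. 3 ^ m))"
    by (intro liminf_subseq_mono mono) simp
  also have "\<dots> \<le> limsup (?X \<circ> (\<lambda>m. 3 ^ m))"
    by (intro Liminf_le_Limsup) simp
  also have "\<dots> \<le> ereal (9 / 10)"
    by (intro Limsup_bounded eventually_sequentiallyI[of 4])
       (simp only: o_def ereal_less_eq stochasticity_ratio_3_power)
  also have "\<dots> < 1"
    by simp
  finally show "liminf ?X < 1" .
  have "1 < ereal (26 / 25)"
    by simp
  also have "\<dots> \<le> liminf (?X \<circ> (\<lambda>m. 53 ^ m))"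
    by (intro Liminf_bounded eventually_sequentiallyI[of 1])
       (simp only: o_def ereal_less_eq stochasticity_ratio_53_power)
  also have "\<dots> \<le> limsup (?X \<circ> (\<lambda>m. 53 ^ m))"
    by (intro Liminf_le_Limsup) simp
  also have "\<dots> \<le> limsup ?X"
    by (intro limsup_subseq_mono mono) simp
  finally show "1 < limsup ?X" .
qed

end
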